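(* For every $t\in\mathbb{C}$ with $\Re t>0$, every integer $m\ge 0$, and either choice of sign (the same throughout), $$\int_{-\infty}^{\infty}x\,e^{\pm mx-t\cosh x}\,dx=\pm m!\sum_{k=0}^{m-1}\frac{K_{k}(t)}{k!\,(m-k)}\left(\frac{t}{2}\right)^{k-m}.$$
   Context: $I_\nu(t)=\sum_{k=0}^{\infty}\frac{1}{k!\,\Gamma(k+\nu+1)}\left(\frac{t}{2}\right)^{2k+\nu}$ is the modified Bessel function of the first kind (principal branch, $-\pi<\arg t\le\pi$; $1/\Gamma$ is zero at the poles of $\Gamma$), and $K_\nu(t)=\frac{\pi}{2}\,\frac{I_{-\nu}(t)-I_\nu(t)}{\sin\pi\nu}$ (for integer $\nu$, the limit in $\nu$) is the modified Bessel function of the second kind. Empty sums are $0$. *)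

theory Defs
  imports "HOL-Analysis.Analysis"
begin

text \<open>
  The modified Bessel function of the first kind, for complex order and argument \<open>t \<noteq> 0\<close>.
  The function \<open>rGamma\<close> is the entire function \<open>1 / Gamma\<close>, which vanishes at the poles of
  \<open>Gamma\<close>; complex \<open>powr\<close> is the principal branch, with \<open>- pi < Arg t \<le> pi\<close>.
  At \<open>t = 0\<close> the value is \<open>0\<close> for every order, since \<open>0 powr a = 0\<close>.
\<close>
definition bessel_I :: "complex \<Rightarrow> complex \<Rightarrow> complex" where
  "bessel_I \<nu> t =
     (\<Sum>k. rGamma (of_nat k + \<nu> + 1) / fact k * (t / 2) powr (2 * of_nat k + \<nu>))"

text \<open>
  The modified Bessel function of the second kind. At integer orders, where the quotient
  has vanishing denominator, it is the limit in the (complex) order; \<open>at \<nu>\<close> is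
  the punctured neighbourhood filter.
\<close>
definition bessel_K :: "complex \<Rightarrow> complex \<Rightarrow> complex" where
  "bessel_K \<nu> t =
     (let q = (\<lambda>\<mu>. of_real pi / 2 * ((bessel_I (- \<mu>) t - bessel_I \<mu> t) / sin (of_real pi * \<mu>)))
      in if \<nu> \<in> \<int> then Lim (at \<nu>) q else q \<nu>)"

end

theory Submission
  imports Defs "HOL-Real_Asymp.Real_Asymp"
begin

text \<open>
  Put \<open>z = t / 2\<close>, \<open>F \<mu> = \<integral> exp (\<mu> x - t cosh x) dx\<close> and \<open>G \<mu> = \<integral> x exp (\<mu> x - t cosh x) dx\<close>, over the
  whole real line.

  To see that \<open>F \<nu> = 2 K\<^sub>\<nu>\<close>, split \<open>F \<mu>\<close> at \<open>0\<close>. For non-integral \<open>\<mu>\<close>, expanding \<open>exp (- z exp (- x))\<close>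
  on \<open>x > 0\<close> reduces the half-line integral to the incomplete Gamma integrals over \<open>x > 0\<close>,
  \<open>\<integral> exp (s x - z exp x) dx = \<Gamma>(s) z\<^bsup>-s\<^esup> - (\<Sum>n. (-z)\<^sup>n / (n! (s + n)))\<close> with \<open>s = \<mu> - k\<close>. By the reflection
  formula the Gamma terms sum to \<open>\<pi> / sin (\<pi> \<mu>)\<close> times \<open>I\<close> at order \<open>- \<mu>\<close>, and the remaining double
  series is odd in \<open>\<mu>\<close>, so it cancels against the one from the other half-line. Integral orders
  follow by continuity of \<open>F\<close>.

  Integrating the derivatives of \<open>exp (\<mu> x - t cosh x)\<close> and \<open>x exp (\<mu> x - t cosh x)\<close> gives
  \<open>z (F (\<mu> + 1) - F (\<mu> - 1)) = \<mu> F \<mu>\<close> and \<open>z (G (\<mu> + 1) - G (\<mu> - 1)) = F \<mu> + \<mu> G \<mu>\<close>. As \<open>G\<close> is odd, this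
  determines \<open>G\<close> at the integers, and the right-hand side satisfies the same recurrence.
\<close>

section \<open>Gamma integrals in an exponential variable\<close>

text \<open>The exponential maps the whole line onto the positive half-line. The change of variables
  is applied to real-valued functions, hence to the real and imaginary parts separately.\<close>

lemma absolutely_integrable_exp_substitution:
  fixes f :: "real \<Rightarrow> complex"
  assumes "f absolutely_integrable_on {0<..}"
  shows "(\<lambda>x. exp x *\<^sub>R f (exp x)) absolutely_integrable_on UNIV"
    and "integral UNIV (\<lambda>x. exp x *\<^sub>R f (exp x)) = integral {0<..} f"
proof -
  have im: "range (exp :: real \<Rightarrow> real) = {0<..}"
    by (auto simp: image_iff intro: exp_ln[symmetric])
  have *: "(\<lambda>x. \<bar>exp x\<bar> * h (exp x)) absolutely_integrable_on UNIV \<and>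
           integral UNIV (\<lambda>x. \<bar>exp x\<bar> * h (exp x)) = integral {0<..} h"
    if "h absolutely_integrable_on {0<..}" for h :: "real \<Rightarrow> real"
    using has_absolute_integral_change_of_variables_1'[of UNIV exp exp h "integral {0<..} h"] that im
    by (auto intro!: derivative_eq_intros simp: inj_on_def)
  have iff: "h absolutely_integrable_on S \<longleftrightarrow>
      (\<lambda>x. Re (h x)) absolutely_integrable_on S \<and> (\<lambda>x. Im (h x)) absolutely_integrable_on S"
    for h :: "real \<Rightarrow> complex" and S
    by (subst absolutely_integrable_componentwise_iff) (simp add: Basis_complex_def)
  have R: "(\<lambda>x. Re (f x)) absolutely_integrable_on {0<..}"
    and I: "(\<lambda>x. Im (f x)) absolutely_integrable_on {0<..}"
    using assms iff by auto
  show ai: "(\<lambda>x. exp x *\<^sub>R f (exp x)) absolutely_integrable_on UNIV"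
    using *[OF R] *[OF I] by (simp add: iff)
  have "integral UNIV (\<lambda>x. Re (exp x *\<^sub>R f (exp x))) = Re (integral {0<..} f)"
    "integral UNIV (\<lambda>x. Im (exp x *\<^sub>R f (exp x))) = Im (integral {0<..} f)"
    using *[OF R] *[OF I] set_lebesgue_integral_eq_integral(1)[OF assms]
      integral_linear[of f "{0<..}" Re] integral_linear[of f "{0<..}" Im]
    by (auto simp: o_def bounded_linear_Re bounded_linear_Im)
  then show "integral UNIV (\<lambda>x. exp x *\<^sub>R f (exp x)) = integral {0<..} f"
    using set_lebesgue_integral_eq_integral(1)[OF ai]
      integral_linear[of "\<lambda>x. exp x *\<^sub>R f (exp x)" UNIV Re] integral_linear[of "\<lambda>x. exp x *\<^sub>R f (exp x)" UNIV Im]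
    by (simp add: complex_eq_iff o_def bounded_linear_Re bounded_linear_Im)
qed

text \<open>Euler's integral after \<open>t = exp x\<close>: the Jacobian turns
  \<open>t powr (s - 1)\<close> into \<open>exp (s * x)\<close>. On this scale the incomplete Gamma
  integrals are those over the two half-lines.\<close>

lemma Gamma_integral_exp:
  assumes "Re s > 0"
  shows "has_bochner_integral lborel (\<lambda>x::real. exp (s * of_real x - of_real (exp x))) (Gamma s)"
proof -
  define f where "f t = of_real t powr (s - 1) / of_real (exp t)" for t :: real
  have f: "f absolutely_integrable_on {0<..}" "integral {0<..} f = Gamma s"
    using absolutely_integrable_Gamma_integral'[OF assms] Gamma_integral_complex'[OF assms]
    by (auto simp: f_def[abs_def] integral_unique)
  have e: "exp x *\<^sub>R f (exp x) = exp (s * of_real x - of_real (exp x))" for x :: real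
    by (simp add: f_def powr_def Ln_of_real scaleR_conv_of_real exp_of_real[symmetric] 
        flip: exp_add exp_diff del: of_real_exp) (simp add: algebra_simps exp_add exp_diff exp_minus exp_of_real)
  note * = absolutely_integrable_exp_substitution[OF f(1), unfolded e f(2)]
  \<comment> \<open>\<open>integrable_completion\<close> passes from Lebesgue measure, to which
    absolute integrability refers, to \<open>lborel\<close>.\<close>
  have i: "integrable lborel (\<lambda>x::real. exp (s * of_real x - of_real (exp x)))"
    using *(1) by (auto simp: set_integrable_def integrable_completion)
  then show ?thesis
    using *(2) integral_lborel[OF i] by (simp add: has_bochner_integral_iff)
qed

text \<open>Translation by \<open>ln R\<close> multiplies \<open>exp x\<close> by \<open>R\<close>
  and \<open>exp (s * x)\<close> by \<open>R powr s\<close>; the latter factor is divided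
  out.\<close>

lemma Gamma_integral_exp_scaled:
  assumes "Re s > 0" "R > 0"
  shows "has_bochner_integral lborel (\<lambda>x::real. exp (s * of_real x - of_real R * of_real (exp x)))
           (Gamma s * of_real R powr (- s))"
proof -
  have "has_bochner_integral lborel (\<lambda>x::real. exp (s * of_real (ln R + 1 * x) - of_real (exp (ln R + 1 * x)))) (Gamma s)"
    using Gamma_integral_exp[OF assms(1)]
    by (subst (asm) lborel_has_bochner_integral_real_affine_iff[of 1 _ _ "ln R"]) auto
  then have "has_bochner_integral lborel (\<lambda>x::real. of_real R powr (- s) * exp (s * of_real (ln R + 1 * x) - of_real (exp (ln R + 1 * x)))) (of_real R powr (- s) * Gamma s)"
    by (rule has_bochner_integral_mult_right) 
  moreover have "of_real R powr (- s) * exp (s * of_real (ln R + 1 * x) - of_real (exp (ln R + 1 * x)))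
     = exp (s * of_real x - of_real R * of_real (exp x))" for x :: real
    using assms by (simp add: powr_def Ln_of_real exp_add flip: exp_add exp_diff del: of_real_exp)
       (simp add: algebra_simps exp_add exp_diff exp_minus exp_of_real)
  ultimately show ?thesis
    by (simp add: mult.commute)
qed

lemma integrable_exp_exp:
  fixes a c :: real
  assumes "a > 0" "c > 0"
  shows "integrable lborel (\<lambda>x::real. exp (a * x - c * exp x))"
proof -
  have "integrable lborel (\<lambda>x::real. norm (exp (complex_of_real a * of_real x - of_real c * of_real (exp x))))"
    using Gamma_integral_exp_scaled[of "of_real a" c] assms
    by (intro integrable_norm) (auto simp: has_bochner_integral_iff)
  then show ?thesis by simp
qed

text \<open>The partial sums of the exponential series are dominated by
  \<open>exp (norm (a x)) * norm (b x)\<close>, so dominated convergence allows termwise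
  integration. It serves three expansions: about a real \<open>R\<close>, on \<open>x < 0\<close>,
  and on \<open>x > 0\<close>.\<close>

lemma integral_exp_series:
  fixes a b :: "real \<Rightarrow> complex"
  assumes [measurable]: "a \<in> borel_measurable borel" "b \<in> borel_measurable borel"
    and w: "integrable lborel (\<lambda>x. exp (norm (a x)) * norm (b x))"
  shows "integrable lborel (\<lambda>x. exp (a x) * b x)"
    and "integrable lborel (\<lambda>x. a x ^ n / fact n * b x)"
    and "(\<lambda>n. LBINT x. a x ^ n / fact n * b x) sums (LBINT x. exp (a x) * b x)"
proof -
  have bd: "(\<Sum>n<N. norm (a x) ^ n / fact n) \<le> exp (norm (a x))" for N x
    using exp_converges[of "norm (a x)"] sum_le_suminf[of "\<lambda>n. norm (a x) ^ n / fact n" "{..<N}"]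
    by (auto simp: sums_iff divide_inverse mult.commute)
  have bd1: "norm (a x) ^ n / fact n \<le> exp (norm (a x))" for n x
    using bd[of x "Suc n"] sum_nonneg[of "{..<n}" "\<lambda>n. norm (a x) ^ n / fact n"] by simp
  have int: "integrable lborel (\<lambda>x. a x ^ n / fact n * b x)" for n
    by (rule Bochner_Integration.integrable_bound[OF w])
       (auto simp: norm_mult norm_divide norm_power simp del: times_divide_eq_left intro!: AE_I2 mult_right_mono bd1)
  then show "integrable lborel (\<lambda>x. a x ^ n / fact n * b x)" .
  have lim: "AE x in lborel. (\<lambda>N. \<Sum>n<N. a x ^ n / fact n * b x) \<longlonglongrightarrow> exp (a x) * b x"
  proof (rule AE_I2)
    fix x
    have "(\<lambda>n. a x ^ n / fact n * b x) sums (exp (a x) * b x)"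
      using exp_converges[of "a x"]
      by (intro sums_mult2) (simp add: scaleR_conv_of_real divide_inverse mult.commute)
    then show "(\<lambda>N. \<Sum>n<N. a x ^ n / fact n * b x) \<longlonglongrightarrow> exp (a x) * b x"
      by (simp add: sums_def)
  qed
  have dom: "AE x in lborel. norm (\<Sum>n<N. a x ^ n / fact n * b x) \<le> exp (norm (a x)) * norm (b x)" for N
  proof (rule AE_I2)
    fix x
    have "norm (\<Sum>n<N. a x ^ n / fact n * b x) \<le> (\<Sum>n<N. norm (a x) ^ n / fact n) * norm (b x)"
      by (simp add: sum_distrib_right sum_norm_le norm_mult norm_divide norm_power)
    also have "\<dots> \<le> exp (norm (a x)) * norm (b x)"
      by (intro mult_right_mono bd) auto
    finally show "norm (\<Sum>n<N. a x ^ n / fact n * b x) \<le> exp (norm (a x)) * norm (b x)" .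
  qed
  show "integrable lborel (\<lambda>x. exp (a x) * b x)"
    by (rule integrable_dominated_convergence[OF _ _ w lim dom]) auto
  have "(\<lambda>N. LBINT x. (\<Sum>n<N. a x ^ n / fact n * b x)) \<longlonglongrightarrow> (LBINT x. exp (a x) * b x)"
    by (rule integral_dominated_convergence[OF _ _ w lim dom]) auto
  then show "(\<lambda>n. LBINT x. a x ^ n / fact n * b x) sums (LBINT x. exp (a x) * b x)"
    using int by (simp add: sums_def Bochner_Integration.integral_sum)
qed

text \<open>Squaring turns the condition into \<open>(norm z)^2 < 2 * R * Re z\<close>, so every
  large \<open>R\<close> works; the chosen one is twice the threshold.\<close>

lemma Re_gt_0_imp_in_disc:
  fixes z :: complex
  assumes "Re z > 0"
  obtains R :: real where "R > 0" "norm (z - of_real R) < R"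
proof -
  define R where "R = (norm z)\<^sup>2 / Re z"
  have R: "R > 0" "R * Re z = (norm z)\<^sup>2" "(norm z)\<^sup>2 > 0" using assms
    by (auto simp: R_def intro!: divide_pos_pos)
  have "(norm (z - of_real R))\<^sup>2 = (norm z)\<^sup>2 - 2 * (R * Re z) + R\<^sup>2"
    unfolding cmod_power2 by (simp add: power2_eq_square algebra_simps)
  also have "\<dots> < R\<^sup>2" using R by simp
  finally have "norm (z - of_real R) < R"
    using R(1) by (simp add: power_less_imp_less_base)
  with R(1) show thesis by (rule that)
qed

text \<open>Both sides are expanded in powers of \<open>z - R\<close>, for a real \<open>R\<close> whose disc of radius \<open>R\<close> contains \<open>z\<close>.\<close>
lemma Gamma_integral_exp_complex:
  fixes s z :: complex
  assumes s: "Re s > 0" and z: "Re z > 0"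
  shows "has_bochner_integral lborel (\<lambda>x::real. exp (s * of_real x - z * of_real (exp x)))
           (Gamma s * z powr (- s))"
proof -
  obtain R where R: "R > 0" "norm (z - of_real R) < R" using Re_gt_0_imp_in_disc[OF z] .
  define h where "h = z - of_real R"
  define a where "a = (\<lambda>x::real. - h * of_real (exp x))"
  define b where "b = (\<lambda>x::real. exp (s * of_real x - of_real R * of_real (exp x)))"
  have meas: "a \<in> borel_measurable borel" "b \<in> borel_measurable borel"
    by (auto simp: a_def b_def)
  \<comment> \<open>The disc condition enters here: \<open>norm h < R\<close> leaves the majorant a
    positive decay rate \<open>R - norm h\<close>.\<close>
  have "exp (norm (a x)) * norm (b x) = exp (Re s * x - (R - norm h) * exp x)" for x
    by (simp add: a_def b_def norm_mult algebra_simps flip: exp_add)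
  then have w: "integrable lborel (\<lambda>x. exp (norm (a x)) * norm (b x))"
    using integrable_exp_exp[of "Re s" "R - norm h"] s R(2) by (simp add: h_def)
  have eq: "exp (a x) * b x = exp (s * of_real x - z * of_real (exp x))" for x
    by (simp add: a_def b_def h_def algebra_simps flip: exp_add)
  \<comment> \<open>Each term is a scaled Gamma integral at \<open>s + n\<close>. As
    \<open>Gamma (s + n) / Gamma s\<close> is a Pochhammer symbol, the terms are those of the
    binomial series of \<open>(1 + h / R) powr (- s)\<close>.\<close>
  have "(LBINT x. a x ^ n / fact n * b x) = Gamma s * of_real R powr (- s) * (((- s) gchoose n) * (h / of_real R) ^ n)" for n
  proof -
    have "a x ^ n / fact n * b x = (- h) ^ n / fact n * exp ((s + of_nat n) * of_real x - of_real R * of_real (exp x))" for x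
    proof -
      have "a x ^ n = (- h) ^ n * exp (of_nat n * of_real x)"
        unfolding a_def by (simp only: power_mult_distrib exp_of_nat_mult exp_of_real)
      then show ?thesis
        by (simp add: b_def algebra_simps exp_add exp_diff)
    qed
    then have "(LBINT x. a x ^ n / fact n * b x) = (- h) ^ n / fact n * (Gamma (s + of_nat n) * of_real R powr (- (s + of_nat n)))"
      using Gamma_integral_exp_scaled[of "s + of_nat n" R] s R(1)
      by (simp add: has_bochner_integral_iff)
    moreover have "s \<notin> \<int>\<^sub>\<le>\<^sub>0" using s by (auto elim!: nonpos_Ints_cases)
    moreover have "complex_of_real R powr (- (s + of_nat n)) = of_real R powr (- s) / of_real R ^ n"
      using R(1) by (simp add: powr_diff powr_nat')
    moreover from \<open>s \<notin> \<int>\<^sub>\<le>\<^sub>0\<close> have "Gamma s \<noteq> 0" by (simp add: Gamma_eq_zero_iff)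
    ultimately show ?thesis
      by (simp add: gbinomial_pochhammer pochhammer_Gamma power_divide power_minus' divide_simps power_minus[of h])
  qed
  moreover have "(\<lambda>n. Gamma s * of_real R powr (- s) * (((- s) gchoose n) * (h / of_real R) ^ n)) sums
      (Gamma s * of_real R powr (- s) * (1 + h / of_real R) powr (- s))"
    using R by (intro sums_mult gen_binomial_complex) (simp add: h_def norm_divide)
  ultimately have "(LBINT x. exp (a x) * b x) = Gamma s * (of_real R powr (- s) * (1 + h / of_real R) powr (- s))"
    using integral_exp_series(3)[OF meas w] by (simp add: sums_iff mult.assoc)
  \<comment> \<open>Principal powers multiply here because the factor \<open>R\<close> is a positive
    real.\<close>
  also have "of_real R powr (- s) * (1 + h / of_real R) powr (- s) = z powr (- s)"
    using R(1) by (subst powr_times_real_left[symmetric]) (auto simp: h_def field_simps)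
  finally show ?thesis
    using integral_exp_series(1)[OF meas w] unfolding eq has_bochner_integral_iff by blast
qed

section \<open>Integrals over the negative half-line\<close>

lemma set_integrable_exp_lessThan:
  assumes "a > 0"
  shows "set_integrable lborel {..<0} (\<lambda>x::real. exp (a * x))"
  unfolding set_integrable_def
proof (rule Bochner_Integration.integrable_bound)
  \<comment> \<open>For \<open>x < 0\<close> the factor \<open>exp (- exp x)\<close> exceeds
    \<open>exp (- 1)\<close>, and \<open>exp 1\<close> compensates for it.\<close>
  show "integrable lborel (\<lambda>x::real. exp 1 * exp (a * x - 1 * exp x))"
    using integrable_exp_exp[of a 1] assms by simp
  show "AE x in lborel. norm (indicat_real {..<0} x *\<^sub>R exp (a * x)) \<le> norm (exp 1 * exp (a * x - 1 * exp x))"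
    by (intro AE_I2) (auto simp: indicator_def simp flip: exp_add)
qed auto

lemma integral_exp_lessThan:
  fixes s :: complex
  assumes "Re s > 0"
  shows "(LBINT x:{..<0}. exp (s * of_real x)) = 1 / s"
proof -
  have "(LBINT x=-\<infinity>..ereal 0. exp (s * of_real x)) = exp (s * of_real 0) / s - 0"
  proof (rule interval_integral_FTC_integrable)
    show "((\<lambda>x. exp (s * of_real x) / s) has_vector_derivative exp (s * of_real x)) (at x)" for x
      using assms by (auto intro!: derivative_eq_intros has_vector_derivative_real_field)
    show "set_integrable lborel (einterval (-\<infinity>) (ereal 0)) (\<lambda>x. exp (s * of_real x))"
    proof -
      have "einterval (-\<infinity>) (ereal 0) = {..<0}" by (auto simp: einterval_def)
      then show ?thesis
        using set_integrable_exp_lessThan[OF assms] unfolding set_integrable_def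
        by (auto elim!: Bochner_Integration.integrable_bound intro!: AE_I2 simp: indicator_def)
    qed
    have "((\<lambda>x::real. exp (Re s * x)) \<longlongrightarrow> 0) at_bot"
      using assms by real_asymp
    then have "((\<lambda>x::real. exp (s * of_real x) / s) \<longlongrightarrow> 0) at_bot"
      by (intro tendsto_divide_zero tendsto_norm_zero_cancel[where f="\<lambda>x. exp (s * of_real x)"]) (simp)
    then show "(((\<lambda>x. exp (s * of_real x) / s) \<circ> real_of_ereal) \<longlongrightarrow> 0) (at_right (-\<infinity>))"
      by (simp add: ereal_tendsto_simps)
    show "(((\<lambda>x. exp (s * of_real x) / s) \<circ> real_of_ereal) \<longlongrightarrow> exp (s * of_real 0) / s) (at_left (ereal 0))"
      unfolding ereal_tendsto_simps using assms by (intro tendsto_intros) auto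
  qed auto
  moreover have "einterval (-\<infinity>) (ereal 0) = {..<0}" by (auto simp: einterval_def)
  ultimately show ?thesis by (simp add: interval_lebesgue_integral_def)
qed

text \<open>On \<open>x < 0\<close> the norm of \<open>z * exp x\<close> is at most
  \<open>norm z\<close>, so the exponential series integrates termwise for every \<open>z\<close>.
  Up to a power of \<open>z\<close>, this is the series of the lower incomplete Gamma
  function.\<close>

lemma integral_exp_exp_lessThan:
  fixes s z :: complex
  assumes "Re s > 0"
  shows "set_integrable lborel {..<0} (\<lambda>x. exp (s * of_real x - z * of_real (exp x)))"
    and "(\<lambda>n. (- z) ^ n / (fact n * (s + of_nat n))) sums
          (LBINT x:{..<0}. exp (s * of_real x - z * of_real (exp x)))"
proof -
  define a where "a = (\<lambda>x::real. - z * of_real (exp x))"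
  define b where "b = (\<lambda>x::real. indicat_real {..<0} x *\<^sub>R exp (s * of_real x))"
  have meas: "a \<in> borel_measurable borel" "b \<in> borel_measurable borel"
    by (auto simp: a_def b_def)
  have "integrable lborel (\<lambda>x. exp (norm z) * (indicat_real {..<0} x *\<^sub>R exp (Re s * x)))"
    using set_integrable_exp_lessThan[OF assms] unfolding set_integrable_def by (intro integrable_mult_right)
  then have w: "integrable lborel (\<lambda>x. exp (norm (a x)) * norm (b x))"
    by (rule Bochner_Integration.integrable_bound)
       (auto intro!: AE_I2 mult_left_le simp: meas a_def b_def indicator_def norm_mult)
  have eq: "exp (a x) * b x = indicat_real {..<0} x *\<^sub>R exp (s * of_real x - z * of_real (exp x))" for x
    by (simp add: a_def b_def algebra_simps flip: exp_add)
  have "(LBINT x. a x ^ n / fact n * b x) = (- z) ^ n / (fact n * (s + of_nat n))" for n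
  proof -
    have "a x ^ n / fact n * b x = (- z) ^ n / fact n * (indicat_real {..<0} x *\<^sub>R exp ((s + of_nat n) * of_real x))" for x
    proof -
      have "a x ^ n = (- z) ^ n * exp (of_nat n * of_real x)"
        unfolding a_def by (simp only: power_mult_distrib exp_of_nat_mult exp_of_real)
      then show ?thesis
        by (simp add: b_def algebra_simps exp_add indicator_def)
    qed
    then have "(LBINT x. a x ^ n / fact n * b x) = (- z) ^ n / fact n * (LBINT x:{..<0}. exp ((s + of_nat n) * of_real x))"
      by (simp only: integral_mult_right_zero set_lebesgue_integral_def)
    then show ?thesis
      using integral_exp_lessThan[of "s + of_nat n"] assms by simp
  qed
  then show "(\<lambda>n. (- z) ^ n / (fact n * (s + of_nat n))) sums
          (LBINT x:{..<0}. exp (s * of_real x - z * of_real (exp x)))"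
    using integral_exp_series(3)[OF meas w] unfolding eq by (simp add: set_lebesgue_integral_def)
  show "set_integrable lborel {..<0} (\<lambda>x. exp (s * of_real x - z * of_real (exp x)))"
    using integral_exp_series(1)[OF meas w] unfolding eq by (simp add: set_integrable_def)
qed

section \<open>Incomplete Gamma integrals\<close>

lemma set_integrable_exp_exp_greaterThan:
  fixes s z :: complex
  assumes z: "Re z > 0"
  shows "set_integrable lborel {0<..} (\<lambda>x::real. exp (s * of_real x - z * of_real (exp x)))"
  unfolding set_integrable_def
proof (rule Bochner_Integration.integrable_bound)
  \<comment> \<open>The slope \<open>\<bar>Re s\<bar> + 1\<close> is positive for every
    \<open>s\<close>, and on \<open>x > 0\<close> raising the slope only enlarges the
    integrand.\<close>
  show "integrable lborel (\<lambda>x::real. exp ((\<bar>Re s\<bar> + 1) * x - Re z * exp x))"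
    using integrable_exp_exp[of "\<bar>Re s\<bar> + 1" "Re z"] z by simp
  have "Re s * x \<le> (\<bar>Re s\<bar> + 1) * x" if "x > 0" for x
    using that by (intro mult_right_mono) auto
  then show "AE x in lborel. norm (indicat_real {0<..} x *\<^sub>R exp (s * of_real x - z * of_real (exp x)))
      \<le> norm (exp ((\<bar>Re s\<bar> + 1) * x - Re z * exp x))"
    by (intro AE_I2) (auto simp: indicator_def)
qed auto

lemma integral_split_at_0:
  fixes f :: "real \<Rightarrow> complex"
  assumes "set_integrable lborel {..<0} f" "set_integrable lborel {0<..} f"
  shows "integrable lborel f"
    and "(LBINT x. f x) = (LBINT x:{..<0}. f x) + (LBINT x:{0<..}. f x)"
proof -
  have U: "set_integrable lborel ({..<0} \<union> {0<..}) f"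
    "(LBINT x:{..<0} \<union> {0<..}. f x) = (LBINT x:{..<0}. f x) + (LBINT x:{0<..}. f x)"
    using assms by (auto intro!: set_integrable_Un set_integral_Un)
  have U1: "has_bochner_integral lborel (\<lambda>x. indicat_real ({..<0} \<union> {0<..}) x *\<^sub>R f x)
      ((LBINT x:{..<0}. f x) + (LBINT x:{0<..}. f x))"
    using U by (simp add: has_bochner_integral_iff set_integrable_def set_lebesgue_integral_def)
  \<comment> \<open>The two half-lines omit only the null set \<open>{0}\<close>.\<close>
  have "has_bochner_integral lborel f ((LBINT x:{..<0}. f x) + (LBINT x:{0<..}. f x))"
    by (rule has_bochner_integral_discrete_difference[of "{0}" lborel, THEN iffD1, rotated -1, OF U1]) (auto simp: indicator_def)
  then show "integrable lborel f"
    and "(LBINT x. f x) = (LBINT x:{..<0}. f x) + (LBINT x:{0<..}. f x)"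
    by (auto simp: has_bochner_integral_iff)
qed

text \<open>The derivative of \<open>exp (s * x - z * exp x)\<close> is \<open>s\<close> times
  itself minus \<open>z\<close> times the same function at \<open>s + 1\<close>; over
  \<open>x > 0\<close> only the boundary value \<open>exp (- z)\<close> at \<open>0\<close>
  survives.\<close>

lemma integral_exp_exp_greaterThan_rec:
  fixes s z :: complex
  assumes z: "Re z > 0"
  shows "s * (LBINT x:{0<..}. exp (s * of_real x - z * of_real (exp x))) =
         z * (LBINT x:{0<..}. exp ((s + 1) * of_real x - z * of_real (exp x))) - exp (- z)"
proof -
  define F where "F = (\<lambda>x::real. exp (s * of_real x - z * of_real (exp x)))"
  define F1 where "F1 = (\<lambda>x::real. exp ((s + 1) * of_real x - z * of_real (exp x)))"
  have E: "einterval (ereal 0) \<infinity> = {0<..}" by (auto simp: einterval_def)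
  have int: "set_integrable lborel {0<..} F" "set_integrable lborel {0<..} F1"
    using set_integrable_exp_exp_greaterThan[OF z] by (auto simp: F_def F1_def)
  have F1: "F1 x = of_real (exp x) * F x" for x
    by (simp add: F_def F1_def exp_of_real algebra_simps exp_add exp_diff)
  have "(LBINT x=ereal 0..\<infinity>. s * F x - z * F1 x) = 0 - exp (- z)"
  proof (rule interval_integral_FTC_integrable)
    show "(F has_vector_derivative s * F x - z * F1 x) (at x)" for x
    proof -
      have "((\<lambda>w. exp (s * w - z * exp w)) has_field_derivative
          (s - z * exp (of_real x)) * exp (s * of_real x - z * exp (of_real x))) (at (of_real x))"
        by (auto intro!: derivative_eq_intros)
      then show ?thesis
        using has_vector_derivative_real_field[of "\<lambda>w. exp (s * w - z * exp w)" _ x UNIV]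
        unfolding F1 by (simp add: F_def[abs_def] exp_of_real algebra_simps)
    qed
    show "set_integrable lborel (einterval (ereal 0) \<infinity>) (\<lambda>x. s * F x - z * F1 x)"
      unfolding E by (intro set_integral_diff set_integrable_mult_right int)
    have "((\<lambda>x::real. exp (Re s * x - Re z * exp x)) \<longlongrightarrow> 0) at_top"
      using z by real_asymp
    then have "(F \<longlongrightarrow> 0) at_top"
      by (intro tendsto_norm_zero_cancel[where f=F]) (simp add: F_def)
    then show "((F \<circ> real_of_ereal) \<longlongrightarrow> 0) (at_left \<infinity>)"
      by (simp add: ereal_tendsto_simps)
    have "(F \<longlongrightarrow> F 0) (at_right 0)"
      unfolding F_def by (intro tendsto_intros)
    then show "((F \<circ> real_of_ereal) \<longlongrightarrow> exp (- z)) (at_right (ereal 0))"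
      unfolding ereal_tendsto_simps by (simp add: F_def)
    show "isCont (\<lambda>x. s * F x - z * F1 x) x" for x
      unfolding F_def F1_def by (intro continuous_intros)
  qed auto
  then have "(LBINT x:{0<..}. s * F x - z * F1 x) = - exp (- z)"
    by (simp add: interval_lebesgue_integral_def E)
  then have "s * (LBINT x:{0<..}. F x) - z * (LBINT x:{0<..}. F1 x) = - exp (- z)"
    using int by (subst (asm) set_integral_diff) (auto intro: set_integrable_mult_right)
  then show ?thesis
    unfolding F_def F1_def by (simp add: algebra_simps)
qed

lemma summable_exp_div:
  fixes s w :: complex
  assumes "s \<notin> \<int>\<^sub>\<le>\<^sub>0"
  shows "summable (\<lambda>n. w ^ n / (fact n * (s + of_nat n)))"
proof -
  have sm: "summable (\<lambda>n. norm w ^ n / fact n)"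
    using summable_exp[of "norm w"] by (simp add: divide_inverse mult.commute)
  obtain N :: nat where N: "real N \<ge> norm s + 1" using real_arch_simple by blast
  have "norm (w ^ n / (fact n * (s + of_nat n))) \<le> norm w ^ n / fact n" if "n \<ge> N" for n
  proof -
    from that have "1 \<le> real n - norm s" using N by linarith
    also have "\<dots> \<le> norm (s + of_nat n)"
      using norm_diff_ineq[of "of_nat n" s] by (simp add: add.commute)
    finally have "1 \<le> norm (s + of_nat n)" .
    then show "norm (w ^ n / (fact n * (s + of_nat n))) \<le> norm w ^ n / fact n"
      using mult_left_mono[of 1 "norm (s + of_nat n)" "fact n"]
      by (simp add: norm_divide norm_mult norm_power frac_le)
  qed
  then show ?thesis by (rule summable_comparison_test'[OF sm])
qed

text \<open>From \<open>s / (s + n) = 1 - n / (s + n)\<close>: the first part sums to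
  \<open>exp w\<close>, the second is, after an index shift, \<open>w\<close> times the series at
  \<open>s + 1\<close>. For \<open>w = - z\<close>, minus the series thus obeys the recurrence of
  the half-line integral.\<close>

lemma exp_div_series_rec:
  fixes s w :: complex
  assumes "s \<notin> \<int>\<^sub>\<le>\<^sub>0"
  shows "s * (\<Sum>n. w ^ n / (fact n * (s + of_nat n))) =
         exp w - w * (\<Sum>n. w ^ n / (fact n * ((s + 1) + of_nat n)))"
proof -
  have nz: "s + of_nat n \<noteq> 0" for n
  proof
    assume "s + of_nat n = 0"
    then have "s = - of_nat n" by (simp add: eq_neg_iff_add_eq_0)
    then show False using assms by simp
  qed
  have s1: "s + 1 \<notin> \<int>\<^sub>\<le>\<^sub>0"
    using assms plus_one_in_nonpos_Ints_imp by blast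
  have e: "(\<lambda>n. w ^ n / fact n) sums exp w"
    using exp_converges[of w] by (simp add: scaleR_conv_of_real divide_inverse mult.commute)
  have "(\<lambda>n. w * (w ^ n / (fact n * ((s + 1) + of_nat n)))) sums
      (w * (\<Sum>n. w ^ n / (fact n * ((s + 1) + of_nat n))))"
    using summable_exp_div[OF s1, of w] by (intro sums_mult summable_sums)
  moreover have "w * (w ^ n / (fact n * ((s + 1) + of_nat n))) = of_nat (Suc n) * w ^ Suc n / (fact (Suc n) * (s + of_nat (Suc n)))" for n
    using nz[of "Suc n"] of_nat_neq_0[of n, where ?'a = complex] by (simp add: divide_simps) (simp add: algebra_simps)
  ultimately have "(\<lambda>n. of_nat (Suc n) * w ^ Suc n / (fact (Suc n) * (s + of_nat (Suc n)))) sums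
      (w * (\<Sum>n. w ^ n / (fact n * ((s + 1) + of_nat n))))" by simp
  \<comment> \<open>The term at index \<open>0\<close> vanishes, so the shift leaves the sum
    unchanged.\<close>
  then have "(\<lambda>n. of_nat n * w ^ n / (fact n * (s + of_nat n))) sums
      (w * (\<Sum>n. w ^ n / (fact n * ((s + 1) + of_nat n))))"
    by (subst (asm) sums_Suc_iff) simp
  from sums_diff[OF e this]
  have "(\<lambda>n. w ^ n / fact n - of_nat n * w ^ n / (fact n * (s + of_nat n))) sums
      (exp w - w * (\<Sum>n. w ^ n / (fact n * ((s + 1) + of_nat n))))" .
  moreover have "w ^ n / fact n - of_nat n * w ^ n / (fact n * (s + of_nat n)) = s * (w ^ n / (fact n * (s + of_nat n)))" for n
    using nz[of n] by (simp add: divide_simps) (simp add: algebra_simps)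
  ultimately have "(\<lambda>n. s * (w ^ n / (fact n * (s + of_nat n)))) sums
      (exp w - w * (\<Sum>n. w ^ n / (fact n * ((s + 1) + of_nat n))))" by simp
  then show ?thesis
    using suminf_mult[OF summable_exp_div[OF assms, of w], of s] by (simp only: sums_iff)
qed

text \<open>For \<open>Re s > 0\<close> the half-line \<open>x < 0\<close> is subtracted from the full Gamma integral; both sides satisfy
  the same recurrence in \<open>s\<close>, which reaches the remaining \<open>s\<close>.\<close>
lemma integral_exp_exp_greaterThan:
  fixes s z :: complex
  assumes z: "Re z > 0" and s: "s \<notin> \<int>\<^sub>\<le>\<^sub>0"
  shows "(LBINT x:{0<..}. exp (s * of_real x - z * of_real (exp x))) =
         Gamma s * z powr (- s) - (\<Sum>n. (- z) ^ n / (fact n * (s + of_nat n)))"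
proof -
  \<comment> \<open>\<open>N\<close> unit shifts suffice to bring \<open>s\<close> into the right
    half-plane; the induction is on this number.\<close>
  obtain N :: nat where "- Re s < real N" using reals_Archimedean2 by blast
  then have "Re s + real N > 0" by simp
  then show ?thesis using s
  proof (induction N arbitrary: s)
    case 0
    then have s: "Re s > 0" by simp
    note lo = integral_exp_exp_lessThan[OF s, of z]
    show ?case
      using integral_split_at_0(2)[OF lo(1) set_integrable_exp_exp_greaterThan[OF z]]
        Gamma_integral_exp_complex[OF s z] lo(2)
      by (simp add: sums_iff has_bochner_integral_iff eq_diff_eq add.commute)
  next
    case (Suc N)
    have s1: "s + 1 \<notin> \<int>\<^sub>\<le>\<^sub>0" using Suc.prems(2) plus_one_in_nonpos_Ints_imp by blast
    have s0: "s \<noteq> 0" using Suc.prems(2) by auto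
    have z0: "z \<noteq> 0" using z by auto
    have IH: "(LBINT x:{0<..}. exp ((s + 1) * of_real x - z * of_real (exp x))) =
         Gamma (s + 1) * z powr (- (s + 1)) - (\<Sum>n. (- z) ^ n / (fact n * (s + 1 + of_nat n)))"
      using Suc.prems(1) by (intro Suc.IH s1) (simp add: algebra_simps)
    \<comment> \<open>By the functional equation of \<open>Gamma\<close>, the Gamma term satisfies
      the recurrence without its boundary term.\<close>
    have "z * (Gamma (s + 1) * z powr (- (s + 1))) = s * (Gamma s * z powr (- s))"
      using Gamma_plus1[OF Suc.prems(2)] z0 by (simp add: powr_diff)
    moreover have "s * (\<Sum>n. (- z) ^ n / (fact n * (s + of_nat n))) =
         exp (- z) - (- z) * (\<Sum>n. (- z) ^ n / (fact n * ((s + 1) + of_nat n)))"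
      by (rule exp_div_series_rec[OF Suc.prems(2)])
    moreover note integral_exp_exp_greaterThan_rec[OF z, of s, unfolded IH]
    ultimately have "s * (LBINT x:{0<..}. exp (s * of_real x - z * of_real (exp x))) =
        s * (Gamma s * z powr (- s) - (\<Sum>n. (- z) ^ n / (fact n * (s + of_nat n))))"
      unfolding right_diff_distrib by simp
    then show ?case using s0 by (simp only: mult_left_cancel[OF s0])
  qed
qed

section \<open>The Bessel function of the second kind as an integral\<close>

lemma suminf_swap_product_bound:
  fixes c :: "nat \<Rightarrow> nat \<Rightarrow> complex" and g h :: "nat \<Rightarrow> real"
  assumes bound: "\<And>k n. norm (c k n) \<le> g k * h n"
    and g: "summable g" "\<And>k. g k \<ge> 0" and h: "summable h" "\<And>n. h n \<ge> 0"
  shows "summable (\<lambda>k. \<Sum>n. c k n)" and "(\<Sum>k. \<Sum>n. c k n) = (\<Sum>n. \<Sum>k. c k n)"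
proof -
  have has_g: "(g has_sum suminf g) UNIV" and has_h: "(h has_sum suminf h) UNIV"
    using g h by (auto intro!: sums_nonneg_imp_has_sum summable_sums)
  \<comment> \<open>The product of two convergent nonnegative series is summable over pairs, so the
    dominated family can be summed in either order.\<close>
  have "(\<lambda>(k, n). g k * h n) summable_on UNIV \<times> UNIV"
  proof (rule summable_on_SigmaI)
    show "((\<lambda>n. case (k, n) of (k, n) \<Rightarrow> g k * h n) has_sum g k * suminf h) UNIV" for k
      using has_sum_cmult_right[OF has_h, of "g k"] by simp
    show "(\<lambda>k. g k * suminf h) summable_on UNIV"
      using has_sum_cmult_left[OF has_g, of "suminf h"] by (auto simp: summable_on_def)
  qed (use g h in auto)
  then have "(\<lambda>x. norm (case x of (k, n) \<Rightarrow> c k n)) summable_on UNIV \<times> UNIV"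
    by (rule Infinite_Sum.abs_summable_on_comparison_test') (use bound in auto)
  then have sm: "(\<lambda>(k, n). c k n) summable_on UNIV \<times> UNIV"
    by (rule abs_summable_summable)
  then have sm': "(\<lambda>(n, k). c k n) summable_on UNIV \<times> UNIV"
    using summable_on_swap[of "\<lambda>(k, n). c k n" UNIV UNIV] by simp
  have row: "(\<lambda>n. c k n) summable_on UNIV" for k
    using summable_on_SigmaD1[OF sm, of k] by simp
  have col: "(\<lambda>k. c k n) summable_on UNIV" for n
    using summable_on_SigmaD1[OF sm', of n] by simp
  have inf: "infsum f UNIV = suminf f" if "f summable_on UNIV" for f :: "nat \<Rightarrow> complex"
    using has_sum_imp_sums[OF has_sum_infsum[OF that]] by (simp add: sums_iff)
  have r: "(\<lambda>k. \<Sum>n. c k n) summable_on UNIV"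
    using summable_on_Sigma_banach[OF sm] by (simp add: inf[OF row])
  have l: "(\<lambda>n. \<Sum>k. c k n) summable_on UNIV"
    using summable_on_Sigma_banach[OF sm'] by (simp add: inf[OF col])
  show "summable (\<lambda>k. \<Sum>n. c k n)"
    using r by (rule summable_on_imp_summable)
  show "(\<Sum>k. \<Sum>n. c k n) = (\<Sum>n. \<Sum>k. c k n)"
    using infsum_swap_banach[OF sm] by (simp add: inf row col r l)
qed

lemma notin_Ints_minus_of_nat:
  fixes \<mu> :: complex
  assumes "\<mu> \<notin> \<int>"
  shows "\<mu> - of_nat k \<notin> \<int>"
  using assms Ints_add[of "\<mu> - of_nat k" "of_nat k"] by auto

text \<open>The integers form a closed set. The resulting distance bounds all denominators
  \<open>\<mu> - k + n\<close> from below at once.\<close>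

lemma dist_Ints_bound:
  fixes \<mu> :: complex
  assumes "\<mu> \<notin> \<int>"
  obtains \<delta> where "\<delta> > 0" "\<And>j. j \<in> \<int> \<Longrightarrow> \<delta> \<le> norm (\<mu> + j)"
proof -
  obtain \<delta> where \<delta>: "\<delta> > 0" "ball \<mu> \<delta> \<subseteq> - \<int>"
    using open_contains_ball_eq[of "- \<int>" \<mu>] assms by (auto simp: open_Compl)
  have "\<delta> \<le> norm (\<mu> + j)" if "j \<in> \<int>" for j
  proof -
    have "- j \<notin> ball \<mu> \<delta>" using \<delta>(2) Ints_minus[OF that] by blast
    then show ?thesis by (simp add: dist_norm)
  qed
  with \<delta>(1) show thesis by (rule that)
qed

text \<open>Written out, the terms are \<open>(-z)^(k+n) / (k! n! (\<mu> - k + n))\<close>.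
  Exchanging \<open>k\<close> and \<open>n\<close> while negating \<open>\<mu>\<close> negates each
  term, and absolute convergence permits the exchange. This oddness makes the contributions of the
  two half-lines cancel.\<close>

lemma half_line_double_series:
  fixes \<mu> z :: complex
  assumes "\<mu> \<notin> \<int>"
  defines "S \<equiv> \<lambda>\<mu>. \<lambda>k. (- z) ^ k / fact k * (\<Sum>n. (- z) ^ n / (fact n * ((\<mu> - of_nat k) + of_nat n)))"
  shows "summable (S \<mu>)" and "suminf (S (- \<mu>)) = - suminf (S \<mu>)"
proof -
  define c where "c = (\<lambda>\<mu> k n. (- z) ^ k / fact k * ((- z) ^ n / (fact n * ((\<mu> - of_nat k) + of_nat n))))"
  have S: "S \<mu> = (\<lambda>k. \<Sum>n. c \<mu> k n)" if "\<mu> \<notin> \<int>" for \<mu>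
  proof
    fix k
    have "\<mu> - of_nat k \<notin> \<int>\<^sub>\<le>\<^sub>0"
      using notin_Ints_minus_of_nat[OF that] nonpos_Ints_subset_Ints by blast
    then show "S \<mu> k = (\<Sum>n. c \<mu> k n)"
      unfolding S_def c_def by (intro suminf_mult[symmetric] summable_exp_div)
  qed
  obtain \<delta> where \<delta>: "\<delta> > 0" "\<And>j. j \<in> \<int> \<Longrightarrow> \<delta> \<le> norm (\<mu> + j)"
    using dist_Ints_bound[OF assms(1)] by metis
  have bound: "norm (c \<mu> k n) \<le> (norm z ^ k / fact k / \<delta>) * (norm z ^ n / fact n)" for k n
  proof -
    have "\<delta> \<le> norm (\<mu> - of_nat k + of_nat n)"
      using \<delta>(2)[of "of_nat n - of_nat k"] by (simp add: algebra_simps)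
    then have "norm z ^ k / fact k * (norm z ^ n / (fact n * norm (\<mu> - of_nat k + of_nat n)))
        \<le> norm z ^ k / fact k * (norm z ^ n / (fact n * \<delta>))"
      using \<delta>(1) by (intro mult_left_mono frac_le mult_left_mono mult_pos_pos) auto
    then show ?thesis
      by (simp add: c_def norm_mult norm_divide norm_power mult_ac)
  qed
  have e: "summable (\<lambda>n. norm z ^ n / fact n)"
    using summable_exp[of "norm z"] by (simp add: divide_inverse mult.commute)
  note swap = suminf_swap_product_bound[OF bound summable_divide[OF e] _ e]
  have nn: "0 \<le> norm z ^ k / fact k / \<delta>" "0 \<le> norm z ^ k / fact k" for k
    using \<delta>(1) by auto
  show "summable (S \<mu>)"
    unfolding S[OF assms(1)] by (rule swap(1)[OF nn])
  have "- \<mu> \<notin> \<int>" using assms(1) by (simp add: minus_in_Ints_iff)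
  have "c (- \<mu>) n = (\<lambda>k. - c \<mu> k n)" for n
  proof
    fix k
    have "- \<mu> - of_nat n + of_nat k = - (\<mu> - of_nat k + of_nat n)" by simp
    then show "c (- \<mu>) n k = - c \<mu> k n" unfolding c_def by (simp only: mult_minus_right divide_minus_right
          mult.commute times_divide_times_eq) (simp add: mult_ac)
  qed
  then have "suminf (S (- \<mu>)) = (\<Sum>n. \<Sum>k. - c \<mu> k n)"
    unfolding S[OF \<open>- \<mu> \<notin> \<int>\<close>] by simp
  also have "\<dots> = - (\<Sum>n. \<Sum>k. c \<mu> k n)"
  proof -
    have "summable (\<lambda>k. c \<mu> k n)" for n
      by (rule summable_comparison_test'[OF summable_mult2[OF summable_divide[OF e]]]) (rule bound)
    then have 1: "(\<lambda>n. \<Sum>k. - c \<mu> k n) = (\<lambda>n. - (\<Sum>k. c \<mu> k n))"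
      by (simp add: suminf_minus)
    have "summable (\<lambda>n. \<Sum>k. c \<mu> k n)"
    \<comment> \<open>The interchange lemma is used with rows and columns reversed.\<close>
    proof (rule suminf_swap_product_bound(1)[OF _ e _ summable_divide[OF e]])
      show "norm (c \<mu> k n) \<le> (norm z ^ n / fact n) * (norm z ^ k / fact k / \<delta>)" for n k
        using bound[of k n] by (simp only: mult.commute)
    qed (rule nn)+
    then show ?thesis unfolding 1 by (simp add: suminf_minus)
  qed
  also have "\<dots> = - suminf (S \<mu>)"
    unfolding S[OF assms(1)] using swap(2)[OF nn] by simp
  finally show "suminf (S (- \<mu>)) = - suminf (S \<mu>)" .
qed

text \<open>As \<open>t * cosh x = t / 2 * exp x + t / 2 * exp (- x)\<close>, only the factor
  involving \<open>exp (- x)\<close>, bounded on \<open>x > 0\<close>, is expanded; its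
  \<open>k\<close>-th power lowers the order by \<open>k\<close>.\<close>

lemma cosh_half_line_series:
  fixes \<mu> t :: complex
  assumes t: "Re t > 0"
  shows "set_integrable lborel {0<..} (\<lambda>x. exp (\<mu> * of_real x - t * of_real (cosh x)))"
    and "(\<lambda>k. (- (t / 2)) ^ k / fact k * (LBINT x:{0<..}. exp ((\<mu> - of_nat k) * of_real x - t / 2 * of_real (exp x))))
           sums (LBINT x:{0<..}. exp (\<mu> * of_real x - t * of_real (cosh x)))"
proof -
  define z where "z = t / 2"
  have z: "Re z > 0" using t by (simp add: z_def)
  define a where "a = (\<lambda>x::real. - z * of_real (exp (- x)))"
  define b where "b = (\<lambda>x::real. indicat_real {0<..} x *\<^sub>R exp (\<mu> * of_real x - z * of_real (exp x)))"
  have meas: "a \<in> borel_measurable borel" "b \<in> borel_measurable borel"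
    by (auto simp: a_def b_def)
  have b: "integrable lborel b"
    using set_integrable_exp_exp_greaterThan[OF z, of \<mu>] unfolding set_integrable_def b_def .
  have "integrable lborel (\<lambda>x. exp (norm z) * norm (b x))"
    by (intro integrable_mult_right integrable_norm b)
  then have w: "integrable lborel (\<lambda>x. exp (norm (a x)) * norm (b x))"
    by (rule Bochner_Integration.integrable_bound)
       (auto intro!: AE_I2 mult_left_le simp: meas a_def b_def indicator_def norm_mult)
  have eq: "exp (a x) * b x = indicat_real {0<..} x *\<^sub>R exp (\<mu> * of_real x - t * of_real (cosh x))" for x
    by (simp add: a_def b_def z_def cosh_def algebra_simps flip: exp_add)
  have "(LBINT x. a x ^ k / fact k * b x) =
      (- z) ^ k / fact k * (LBINT x:{0<..}. exp ((\<mu> - of_nat k) * of_real x - z * of_real (exp x)))" for k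
  proof -
    have "a x ^ k / fact k * b x = (- z) ^ k / fact k *
        (indicat_real {0<..} x *\<^sub>R exp ((\<mu> - of_nat k) * of_real x - z * of_real (exp x)))" for x
    proof -
      have "a x ^ k = (- z) ^ k * exp (of_nat k * of_real (- x))"
        unfolding a_def by (simp only: power_mult_distrib exp_of_nat_mult exp_of_real)
      then show ?thesis
        by (simp add: b_def algebra_simps exp_add exp_diff exp_minus divide_inverse indicator_def)
    qed
    then show ?thesis by (simp only: integral_mult_right_zero set_lebesgue_integral_def)
  qed
  then show "(\<lambda>k. (- (t / 2)) ^ k / fact k * (LBINT x:{0<..}. exp ((\<mu> - of_nat k) * of_real x - t / 2 * of_real (exp x))))
           sums (LBINT x:{0<..}. exp (\<mu> * of_real x - t * of_real (cosh x)))"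
    using integral_exp_series(3)[OF meas w] unfolding eq by (simp add: set_lebesgue_integral_def z_def)
  show "set_integrable lborel {0<..} (\<lambda>x. exp (\<mu> * of_real x - t * of_real (cosh x)))"
    using integral_exp_series(1)[OF meas w] unfolding eq by (simp add: set_integrable_def)
qed

text \<open>The reflection formula at \<open>\<mu> - k\<close>, where the sine contributes the sign
  \<open>(-1)^k\<close>. The sign on the left is supplied later by \<open>(- z)^k\<close>, and the
  \<open>rGamma\<close> factor is the one in the series for
  \<open>bessel_I (- \<mu>)\<close>.\<close>

lemma Gamma_diff_of_nat:
  fixes \<mu> :: complex
  assumes "\<mu> \<notin> \<int>"
  shows "(- 1) ^ k * Gamma (\<mu> - of_nat k) = of_real pi / sin (of_real pi * \<mu>) * rGamma (of_nat k - \<mu> + 1)"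
proof -
  have nz: "Gamma (1 - (\<mu> - of_nat k)) \<noteq> 0"
  proof -
    have "1 - (\<mu> - of_nat k) \<notin> \<int>"
      using notin_Ints_minus_of_nat[OF assms, of k] Ints_diff[OF Ints_1, of "1 - (\<mu> - of_nat k)"] by auto
    then show ?thesis using nonpos_Ints_subset_Ints by (auto simp: Gamma_eq_zero_iff)
  qed
  have "sin (of_real pi * (\<mu> - of_nat k)) = (- 1) ^ k * sin (of_real pi * \<mu>)"
    by (simp add: right_diff_distrib sin_diff mult.commute[of _ "of_nat k"])
  then have "Gamma (\<mu> - of_nat k) * Gamma (1 - (\<mu> - of_nat k)) = of_real pi / ((- 1) ^ k * sin (of_real pi * \<mu>))"
    using Gamma_reflection_complex[of "\<mu> - of_nat k"] by simp
  then have "Gamma (\<mu> - of_nat k) = of_real pi / ((- 1) ^ k * sin (of_real pi * \<mu>)) / Gamma (1 - (\<mu> - of_nat k))"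
    using nz by (simp only: eq_divide_eq) simp
  then have "Gamma (\<mu> - of_nat k) = of_real pi / ((- 1) ^ k * sin (of_real pi * \<mu>)) * rGamma (1 - (\<mu> - of_nat k))"
    by (simp only: rGamma_inverse_Gamma divide_inverse[of _ "Gamma _"])
  then show ?thesis
    by (simp add: algebra_simps)
qed

lemma cosh_half_line:
  fixes \<mu> t :: complex
  assumes t: "Re t > 0" and \<mu>: "\<mu> \<notin> \<int>"
  shows "(LBINT x:{0<..}. exp (\<mu> * of_real x - t * of_real (cosh x))) =
    of_real pi / sin (of_real pi * \<mu>) * bessel_I (- \<mu>) t -
    (\<Sum>k. (- (t / 2)) ^ k / fact k * (\<Sum>n. (- (t / 2)) ^ n / (fact n * ((\<mu> - of_nat k) + of_nat n))))"
proof -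
  define z where "z = t / 2"
  define p where "p = of_real pi / sin (of_real pi * \<mu>)"
  have z: "Re z > 0" "z \<noteq> 0" using t by (auto simp: z_def)
  define S where "S = (\<lambda>k. (- z) ^ k / fact k * (\<Sum>n. (- z) ^ n / (fact n * ((\<mu> - of_nat k) + of_nat n))))"
  \<comment> \<open>\<open>X\<close> lists the terms of \<open>bessel_I (- \<mu>) t\<close>, and
    \<open>S\<close> those of the odd double series.\<close>
  define X where "X = (\<lambda>k. rGamma (of_nat k - \<mu> + 1) / fact k * z powr (2 * of_nat k - \<mu>))"
  have "sin (of_real pi * \<mu>) \<noteq> 0"
    using \<mu> by (auto simp: sin_eq_0)
  then have p: "p \<noteq> 0" by (simp add: p_def)
  have "(- z) ^ k / fact k * (LBINT x:{0<..}. exp ((\<mu> - of_nat k) * of_real x - z * of_real (exp x))) = p * X k - S k" for k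
  proof -
    have "\<mu> - of_nat k \<notin> \<int>\<^sub>\<le>\<^sub>0"
      using notin_Ints_minus_of_nat[OF \<mu>] nonpos_Ints_subset_Ints by blast
    note integral_exp_exp_greaterThan[OF z(1) this]
    moreover have "(- z) ^ k * (Gamma (\<mu> - of_nat k) * z powr (- (\<mu> - of_nat k))) = p * (rGamma (of_nat k - \<mu> + 1) * z powr (2 * of_nat k - \<mu>))"
    proof -
      have "(- z) ^ k = (- 1) ^ k * z powr of_nat k"
        using z(2) by (simp add: power_minus[of z] powr_nat')
      moreover have "z powr of_nat k * z powr (- (\<mu> - of_nat k)) = z powr (2 * of_nat k - \<mu>)"
        by (simp flip: powr_add)
      moreover have "(- z) ^ k * (Gamma (\<mu> - of_nat k) * z powr (- (\<mu> - of_nat k))) =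
          ((- 1) ^ k * Gamma (\<mu> - of_nat k)) * (z powr of_nat k * z powr (- (\<mu> - of_nat k)))"
        unfolding calculation(1) by (simp only: mult_ac)
      ultimately show ?thesis
        using Gamma_diff_of_nat[OF \<mu>, of k, folded p_def] by (simp only: mult.assoc)
    qed
    then have "(- z) ^ k / fact k * (Gamma (\<mu> - of_nat k) * z powr (- (\<mu> - of_nat k))) = p * X k"
      by (simp add: X_def)
    ultimately show ?thesis
      unfolding S_def by (simp only: right_diff_distrib)
  qed
  with cosh_half_line_series(2)[OF t, of \<mu>]
  have *: "(\<lambda>k. p * X k - S k) sums (LBINT x:{0<..}. exp (\<mu> * of_real x - t * of_real (cosh x)))"
    by (simp add: z_def)
  have "summable S"
    using half_line_double_series(1)[OF \<mu>, of z] by (simp add: S_def)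
  then have S: "S sums suminf S" by (rule summable_sums)
  \<comment> \<open>Adding \<open>S\<close> back isolates the Bessel terms; as \<open>p\<close> is
    nonzero, summability of \<open>X\<close> comes as a by-product.\<close>
  from sums_add[OF * S] have "(\<lambda>k. p * X k) sums ((LBINT x:{0<..}. exp (\<mu> * of_real x - t * of_real (cosh x))) + suminf S)"
    by simp
  moreover from this have "summable X" using p summable_mult[of "\<lambda>k. p * X k" "1 / p"] by (simp add: sums_iff)
  moreover have "suminf X = bessel_I (- \<mu>) t"
    by (simp add: X_def bessel_I_def z_def)
  ultimately have "p * bessel_I (- \<mu>) t = (LBINT x:{0<..}. exp (\<mu> * of_real x - t * of_real (cosh x))) + suminf S"
    by (simp add: sums_iff suminf_mult)
  then show ?thesis
    by (simp add: p_def S_def z_def eq_diff_eq)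
qed

text \<open>Reflection turns \<open>x < 0\<close> into \<open>x > 0\<close> with order
  \<open>- \<mu>\<close>. The double series cancel, and the oddness of the sine yields the
  difference of the two \<open>bessel_I\<close> values.\<close>

lemma cosh_integral_eq_bessel_I:
  fixes \<mu> t :: complex
  assumes t: "Re t > 0" and \<mu>: "\<mu> \<notin> \<int>"
  shows "(LBINT x. exp (\<mu> * of_real x - t * of_real (cosh x))) =
    of_real pi * ((bessel_I (- \<mu>) t - bessel_I \<mu> t) / sin (of_real pi * \<mu>))"
proof -
  have ir: "indicat_real {..<0} (0 + (- 1) * x) = indicat_real {0<..} x" for x :: real
    by (auto simp: indicator_def)
  have lo: "(LBINT x:{..<0}. exp (\<mu> * of_real x - t * of_real (cosh x))) = (LBINT x:{0<..}. exp (- \<mu> * of_real x - t * of_real (cosh x)))"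
  proof -
    have "{x::real. - x \<in> {..<0}} = {0<..}" by auto
    then show ?thesis by (subst set_integral_reflect) simp
  qed
  have slo: "set_integrable lborel {..<0} (\<lambda>x. exp (\<mu> * of_real x - t * of_real (cosh x)))"
    using cosh_half_line_series(1)[OF t, of "- \<mu>"] unfolding set_integrable_def
    by (subst lborel_integrable_real_affine_iff[of "-1" _ 0, symmetric]) (simp_all add: ir[simplified])
  have \<mu>': "- \<mu> \<notin> \<int>" using \<mu> by (simp add: minus_in_Ints_iff)
  show ?thesis
    unfolding integral_split_at_0(2)[OF slo cosh_half_line_series(1)[OF t]] lo
      cosh_half_line[OF t \<mu>] cosh_half_line[OF t \<mu>'] half_line_double_series(2)[OF \<mu>]
    by (simp add: diff_divide_distrib algebra_simps)
qed

section \<open>Integrability and decay of the kernel\<close>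

lemma abs_le_exp_abs: "\<bar>x\<bar> \<le> exp \<bar>x\<bar>" for x :: real
  using exp_ge_add_one_self[of "\<bar>x\<bar>"] by linarith

lemma borel_measurable_cosh_real [measurable]: "(cosh :: real \<Rightarrow> real) \<in> borel_measurable borel"
  by (intro borel_measurable_continuous_onI continuous_intros)

text \<open>Since \<open>cosh x\<close> is at least \<open>exp \<bar>x\<bar> / 2\<close>, a
  Gamma-type integrand evaluated at \<open>\<bar>x\<bar>\<close> dominates; adding its mirror image
  covers both signs of \<open>x\<close>.\<close>

lemma integrable_exp_abs_cosh:
  fixes a c :: real
  assumes c: "c > 0"
  shows "integrable lborel (\<lambda>x::real. exp (a * \<bar>x\<bar> - c * cosh x))"
proof (rule Bochner_Integration.integrable_bound)
  let ?g = "\<lambda>x::real. exp ((\<bar>a\<bar> + 1) * x - c / 2 * exp x)"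
  have g: "integrable lborel ?g"
    using integrable_exp_exp[of "\<bar>a\<bar> + 1" "c / 2"] c by simp
  then have "integrable lborel (\<lambda>x. ?g (0 + (-1) * x))"
    by (intro lborel_integrable_real_affine) auto
  with g show "integrable lborel (\<lambda>x. ?g x + ?g (0 + (-1) * x))"
    by (rule Bochner_Integration.integrable_add)
  have le: "exp (a * \<bar>x\<bar> - c * cosh x) \<le> ?g \<bar>x\<bar>" for x
  proof -
    have "a * \<bar>x\<bar> \<le> (\<bar>a\<bar> + 1) * \<bar>x\<bar>" by (intro mult_right_mono) auto
    moreover have "c / 2 * exp \<bar>x\<bar> \<le> c * cosh x"
      using c by (auto simp: cosh_def abs_if field_simps)
    ultimately show ?thesis by simp
  qed
  have "?g \<bar>x\<bar> \<le> ?g x + ?g (0 + (-1) * x)" for x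
    by (auto simp: abs_if)
  with le have "exp (a * \<bar>x\<bar> - c * cosh x) \<le> ?g x + ?g (0 + (-1) * x)" for x
    using order_trans by blast
  then show "AE x in lborel. norm (exp (a * \<bar>x\<bar> - c * cosh x)) \<le> norm (?g x + ?g (0 + (-1) * x))"
    by (intro AE_I2) (simp only: real_norm_def abs_exp_cancel, smt (verit) exp_gt_zero)
qed auto

text \<open>Allowing any \<open>a\<close> above \<open>\<bar>Re \<mu>\<bar>\<close> gives one
  majorant for a bounded set of orders, as continuity in the order requires.\<close>

lemma norm_cosh_kernel_le:
  fixes \<mu> t :: complex
  assumes "\<bar>Re \<mu>\<bar> \<le> a"
  shows "norm (exp (\<mu> * of_real x - t * of_real (cosh x))) \<le> exp (a * \<bar>x\<bar> - Re t * cosh x)"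
proof -
  have "Re \<mu> * x \<le> \<bar>Re \<mu>\<bar> * \<bar>x\<bar>" by (metis abs_ge_self abs_mult)
  also have "\<dots> \<le> a * \<bar>x\<bar>" using assms by (intro mult_right_mono) auto
  finally show ?thesis by simp
qed

text \<open>The factor \<open>x\<close> is absorbed by \<open>abs_le_exp_abs\<close>, which raises
  the slope by one.\<close>

lemma norm_times_cosh_kernel_le:
  fixes \<mu> t :: complex
  shows "norm (of_real x * exp (\<mu> * of_real x - t * of_real (cosh x))) \<le> exp ((\<bar>Re \<mu>\<bar> + 1) * \<bar>x\<bar> - Re t * cosh x)"
proof -
  have "norm (of_real x * exp (\<mu> * of_real x - t * of_real (cosh x))) \<le> exp \<bar>x\<bar> * exp (\<bar>Re \<mu>\<bar> * \<bar>x\<bar> - Re t * cosh x)"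
    unfolding norm_mult norm_of_real
    by (intro mult_mono abs_le_exp_abs norm_cosh_kernel_le) auto
  then show ?thesis by (simp add: algebra_simps flip: exp_add)
qed

lemma integrable_cosh_kernel:
  fixes \<mu> t :: complex
  assumes t: "Re t > 0"
  shows "integrable lborel (\<lambda>x. exp (\<mu> * of_real x - t * of_real (cosh x)))"
    and "integrable lborel (\<lambda>x. of_real x * exp (\<mu> * of_real x - t * of_real (cosh x)))"
proof -
  show "integrable lborel (\<lambda>x. exp (\<mu> * of_real x - t * of_real (cosh x)))"
  proof (rule Bochner_Integration.integrable_bound[OF integrable_exp_abs_cosh[OF t, of "\<bar>Re \<mu>\<bar>"]])
    show "AE x in lborel. norm (exp (\<mu> * of_real x - t * of_real (cosh x))) \<le> norm (exp (\<bar>Re \<mu>\<bar> * \<bar>x\<bar> - Re t * cosh x))"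
      using norm_cosh_kernel_le[OF order_refl, of \<mu>] by (intro AE_I2) (simp only: real_norm_def abs_exp_cancel)
  qed measurable
  show "integrable lborel (\<lambda>x. of_real x * exp (\<mu> * of_real x - t * of_real (cosh x)))"
  proof (rule Bochner_Integration.integrable_bound[OF integrable_exp_abs_cosh[OF t, of "\<bar>Re \<mu>\<bar> + 1"]])
    show "AE x in lborel. norm (of_real x * exp (\<mu> * of_real x - t * of_real (cosh x))) \<le> norm (exp ((\<bar>Re \<mu>\<bar> + 1) * \<bar>x\<bar> - Re t * cosh x))"
      using norm_times_cosh_kernel_le by (intro AE_I2) (simp only: real_norm_def abs_exp_cancel)
  qed measurable
qed

lemma tendsto_exp_abs_cosh:
  fixes a c :: real
  assumes "c > 0"
  shows "((\<lambda>x. exp (a * \<bar>x\<bar> - c * cosh x)) \<longlongrightarrow> 0) at_top"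
    and "((\<lambda>x. exp (a * \<bar>x\<bar> - c * cosh x)) \<longlongrightarrow> 0) at_bot"
proof -
  show *: "((\<lambda>x. exp (a * \<bar>x\<bar> - c * cosh x)) \<longlongrightarrow> 0) at_top"
    unfolding cosh_def real_scaleR_def using assms by real_asymp
  show "((\<lambda>x. exp (a * \<bar>x\<bar> - c * cosh x)) \<longlongrightarrow> 0) at_bot"
    using * by (simp add: filterlim_at_bot_mirror)
qed

lemma tendsto_cosh_kernel:
  fixes \<mu> t :: complex
  assumes t: "Re t > 0" and F: "F = at_top \<or> F = at_bot"
  shows "((\<lambda>x. exp (\<mu> * of_real x - t * of_real (cosh x))) \<longlongrightarrow> 0) F"
    and "((\<lambda>x. of_real x * exp (\<mu> * of_real x - t * of_real (cosh x))) \<longlongrightarrow> 0) F"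
proof -
  have lim: "((\<lambda>x. exp (a * \<bar>x\<bar> - Re t * cosh x)) \<longlongrightarrow> 0) F" for a
    using F tendsto_exp_abs_cosh[OF t] by auto
  show "((\<lambda>x. exp (\<mu> * of_real x - t * of_real (cosh x))) \<longlongrightarrow> 0) F"
    by (rule Lim_null_comparison[OF always_eventually lim]) (use norm_cosh_kernel_le[OF order_refl] in blast)
  show "((\<lambda>x. of_real x * exp (\<mu> * of_real x - t * of_real (cosh x))) \<longlongrightarrow> 0) F"
    by (rule Lim_null_comparison[OF always_eventually lim]) (use norm_times_cosh_kernel_le in blast)
qed

section \<open>Recurrences in the order\<close>

lemma integral_derivative_eq_0:
  fixes F f :: "real \<Rightarrow> complex"
  assumes "\<And>x. (F has_vector_derivative f x) (at x)" "\<And>x. isCont f x" "integrable lborel f"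
    and "(F \<longlongrightarrow> 0) at_top" "(F \<longlongrightarrow> 0) at_bot"
  shows "(LBINT x. f x) = 0"
proof -
  have E: "einterval (-\<infinity>) \<infinity> = UNIV" by (auto simp: einterval_def)
  have "(LBINT x=-\<infinity>..\<infinity>. f x) = 0 - 0"
    by (rule interval_integral_FTC_integrable[where F = F])
       (use assms in \<open>auto simp: ereal_tendsto_simps E set_integrable_def\<close>)
  then show ?thesis
    by (simp add: interval_lebesgue_integral_def E set_lebesgue_integral_def)
qed

lemma isCont_cosh_kernel:
  fixes \<mu> t :: complex
  shows "isCont (\<lambda>x. exp (\<mu> * of_real x - t * of_real (cosh x))) (x::real)"
  by (intro continuous_intros)

text \<open>Differentiation brings down \<open>\<mu> - t * sinh x\<close>, and multiplying the
  kernel by \<open>exp x\<close> or \<open>exp (- x)\<close> shifts the order by \<open>1\<close> or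
  \<open>- 1\<close>.\<close>

lemma has_vector_derivative_cosh_kernel:
  fixes \<mu> t :: complex
  defines "E \<equiv> \<lambda>\<mu> (x::real). exp (\<mu> * of_real x - t * of_real (cosh x))"
  shows "(E \<mu> has_vector_derivative (\<mu> * E \<mu> x - t / 2 * (E (\<mu> + 1) x - E (\<mu> - 1) x))) (at x)"
proof -
  \<comment> \<open>The kernel is the restriction to the real line of an entire function, which is
    differentiated first.\<close>
  have "((\<lambda>w. exp (\<mu> * w - t * cosh w)) has_field_derivative
      (\<mu> - t * sinh (of_real x)) * exp (\<mu> * of_real x - t * cosh (of_real x))) (at (of_real x))"
    by (auto intro!: derivative_eq_intros)
  from has_vector_derivative_real_field[OF this]
  have "(E \<mu> has_vector_derivative (\<mu> - t * sinh (of_real x)) * E \<mu> x) (at x)"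
    by (simp add: E_def cosh_def scaleR_conv_of_real exp_of_real flip: of_real_minus)
  moreover have "E (\<mu> + 1) x = exp (of_real x) * E \<mu> x" "E (\<mu> - 1) x = exp (- of_real x) * E \<mu> x"
    by (simp_all add: E_def algebra_simps flip: exp_add)
  then have "t / 2 * (E (\<mu> + 1) x - E (\<mu> - 1) x) = t * sinh (of_real x) * E \<mu> x"
    by (simp add: sinh_def scaleR_conv_of_real algebra_simps)
  ultimately show ?thesis by (simp only: left_diff_distrib)
qed

text \<open>Once the integral is identified with \<open>2 * bessel_K \<mu> t\<close>, this becomes
  the classical recurrence of \<open>K\<close> in its order.\<close>

lemma cosh_integral_rec:
  fixes \<mu> t :: complex
  assumes t: "Re t > 0"
  defines "F \<equiv> \<lambda>\<mu>. LBINT x. exp (\<mu> * of_real x - t * of_real (cosh x))"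
  shows "t / 2 * (F (\<mu> + 1) - F (\<mu> - 1)) = \<mu> * F \<mu>"
proof -
  define E where "E = (\<lambda>\<mu> (x::real). exp (\<mu> * of_real x - t * of_real (cosh x)))"
  have int: "integrable lborel (E \<mu>)" for \<mu>
    unfolding E_def by (rule integrable_cosh_kernel[OF t])
  have "(LBINT x. \<mu> * E \<mu> x - t / 2 * (E (\<mu> + 1) x - E (\<mu> - 1) x)) = 0"
  proof (rule integral_derivative_eq_0)
    show "(E \<mu> has_vector_derivative (\<mu> * E \<mu> x - t / 2 * (E (\<mu> + 1) x - E (\<mu> - 1) x))) (at x)" for x
      unfolding E_def by (rule has_vector_derivative_cosh_kernel)
    show "isCont (\<lambda>x. \<mu> * E \<mu> x - t / 2 * (E (\<mu> + 1) x - E (\<mu> - 1) x)) x" for x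
      unfolding E_def by (intro continuous_intros isCont_cosh_kernel)
    show "integrable lborel (\<lambda>x. \<mu> * E \<mu> x - t / 2 * (E (\<mu> + 1) x - E (\<mu> - 1) x))"
      by (intro Bochner_Integration.integrable_diff integrable_mult_right int)
    show "(E \<mu> \<longlongrightarrow> 0) at_top" "(E \<mu> \<longlongrightarrow> 0) at_bot"
      unfolding E_def by (rule tendsto_cosh_kernel[OF t], simp)+
  qed
  then have "\<mu> * (LBINT x. E \<mu> x) - t / 2 * ((LBINT x. E (\<mu> + 1) x) - (LBINT x. E (\<mu> - 1) x)) = 0"
    using int by simp
  then show ?thesis by (simp add: F_def E_def)
qed

text \<open>Formally the \<open>\<mu>\<close>-derivative of the preceding recurrence; in the proof
  the extra term \<open>F \<mu>\<close> comes from the product rule.\<close>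

lemma times_cosh_integral_rec:
  fixes \<mu> t :: complex
  assumes t: "Re t > 0"
  defines "F \<equiv> \<lambda>\<mu>. LBINT x. exp (\<mu> * of_real x - t * of_real (cosh x))"
    and "G \<equiv> \<lambda>\<mu>. LBINT x. of_real x * exp (\<mu> * of_real x - t * of_real (cosh x))"
  shows "t / 2 * (G (\<mu> + 1) - G (\<mu> - 1)) = F \<mu> + \<mu> * G \<mu>"
proof -
  define E where "E = (\<lambda>\<mu> (x::real). exp (\<mu> * of_real x - t * of_real (cosh x)))"
  define H where "H = (\<lambda>\<mu> (x::real). of_real x * exp (\<mu> * of_real x - t * of_real (cosh x)))"
  have H: "H \<mu> x = of_real x * E \<mu> x" for \<mu> x by (simp add: H_def E_def)
  have int: "integrable lborel (E \<mu>)" "integrable lborel (H \<mu>)" for \<mu>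
    unfolding E_def H_def by (rule integrable_cosh_kernel[OF t])+
  have "(LBINT x. E \<mu> x + \<mu> * H \<mu> x - t / 2 * (H (\<mu> + 1) x - H (\<mu> - 1) x)) = 0"
  proof (rule integral_derivative_eq_0)
    show "(H \<mu> has_vector_derivative (E \<mu> x + \<mu> * H \<mu> x - t / 2 * (H (\<mu> + 1) x - H (\<mu> - 1) x))) (at x)" for x
    proof -
      have "(E \<mu> has_vector_derivative (\<mu> * E \<mu> x - t / 2 * (E (\<mu> + 1) x - E (\<mu> - 1) x))) (at x)"
        unfolding E_def by (rule has_vector_derivative_cosh_kernel)
      moreover have "(of_real has_vector_derivative (1::complex)) (at x)"
        by (auto intro!: derivative_eq_intros)
      ultimately have "((\<lambda>x. of_real x * E \<mu> x) has_vector_derivative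
          (of_real x * (\<mu> * E \<mu> x - t / 2 * (E (\<mu> + 1) x - E (\<mu> - 1) x)) + 1 * E \<mu> x)) (at x)"
        by (intro has_vector_derivative_mult)
      moreover have "H \<mu> = (\<lambda>x. of_real x * E \<mu> x)" by (simp add: fun_eq_iff H)
      ultimately show ?thesis unfolding H by (simp add: algebra_simps)
    qed
    show "isCont (\<lambda>x. E \<mu> x + \<mu> * H \<mu> x - t / 2 * (H (\<mu> + 1) x - H (\<mu> - 1) x)) x" for x
      unfolding E_def H_def by (intro continuous_intros isCont_cosh_kernel)
    show "integrable lborel (\<lambda>x. E \<mu> x + \<mu> * H \<mu> x - t / 2 * (H (\<mu> + 1) x - H (\<mu> - 1) x))"
      by (intro Bochner_Integration.integrable_diff Bochner_Integration.integrable_add integrable_mult_right int)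
    show "(H \<mu> \<longlongrightarrow> 0) at_top" "(H \<mu> \<longlongrightarrow> 0) at_bot"
      unfolding H_def by (rule tendsto_cosh_kernel[OF t], simp)+
  qed
  then have "(LBINT x. E \<mu> x) + \<mu> * (LBINT x. H \<mu> x) - t / 2 * ((LBINT x. H (\<mu> + 1) x) - (LBINT x. H (\<mu> - 1) x)) = 0"
    using int by simp
  then show ?thesis by (simp add: F_def G_def E_def H_def)
qed

lemma times_cosh_integral_uminus:
  "(LBINT x. of_real x * exp (- \<mu> * of_real x - t * of_real (cosh x))) =
   - (LBINT x. of_real x * exp (\<mu> * of_real x - t * of_real (cosh x)) :: complex)"
  by (subst lborel_integral_real_affine[of "-1" _ 0]) (simp_all flip: integral_minus)

section \<open>Continuity in the order and the passage to integers\<close>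

lemma tendsto_cosh_integral:
  fixes \<nu> t :: complex
  assumes t: "Re t > 0"
  shows "((\<lambda>\<mu>. LBINT x. exp (\<mu> * of_real x - t * of_real (cosh x))) \<longlongrightarrow>
          (LBINT x. exp (\<nu> * of_real x - t * of_real (cosh x)))) (at \<nu>)"
  unfolding tendsto_at_iff_sequentially
proof (intro allI impI)
  fix X :: "nat \<Rightarrow> complex" assume X: "X \<longlonglongrightarrow> \<nu>"
  \<comment> \<open>A convergent sequence of orders is bounded, so \<open>B\<close> gives a single
    majorant for dominated convergence.\<close>
  then obtain B where B: "\<And>n. norm (X n) \<le> B"
    using Bseq_def[of X] convergent_imp_Bseq convergentI by blast
  have "(\<lambda>n. LBINT x. exp (X n * of_real x - t * of_real (cosh x))) \<longlonglongrightarrow> (LBINT x. exp (\<nu> * of_real x - t * of_real (cosh x)))"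
  proof (rule integral_dominated_convergence[OF _ _ integrable_exp_abs_cosh[OF t, of B]])
    show "AE x in lborel. (\<lambda>n. exp (X n * of_real x - t * of_real (cosh x))) \<longlonglongrightarrow> exp (\<nu> * of_real x - t * of_real (cosh x))"
      by (intro AE_I2 tendsto_intros X)
    show "AE x in lborel. norm (exp (X n * of_real x - t * of_real (cosh x))) \<le> exp (B * \<bar>x\<bar> - Re t * cosh x)" for n
      by (intro AE_I2 norm_cosh_kernel_le order_trans[OF abs_Re_le_cmod B])
  qed auto
  then show "((\<lambda>\<mu>. LBINT x. exp (\<mu> * of_real x - t * of_real (cosh x))) \<circ> X) \<longlonglongrightarrow> (LBINT x. exp (\<nu> * of_real x - t * of_real (cosh x)))"
    by (simp add: o_def)
qed

lemma cosh_integral_eq_bessel_K: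
  fixes t \<nu> :: complex
  assumes t: "Re t > 0"
  shows "(LBINT x. exp (\<nu> * of_real x - t * of_real (cosh x))) = 2 * bessel_K \<nu> t"
proof -
  define F where "F = (\<lambda>\<mu>. LBINT x. exp (\<mu> * of_real x - t * of_real (cosh x)))"
  define q where "q = (\<lambda>\<mu>. of_real pi / 2 * ((bessel_I (- \<mu>) t - bessel_I \<mu> t) / sin (of_real pi * \<mu>)))"
  have q: "F \<mu> / 2 = q \<mu>" if "\<mu> \<notin> \<int>" for \<mu>
    using cosh_integral_eq_bessel_I[OF t that] by (simp add: F_def q_def)
  have "Lim (at \<nu>) q = F \<nu> / 2" if "\<nu> \<in> \<int>"
  proof (rule tendsto_Lim)
    \<comment> \<open>Removing the other integers leaves an open neighbourhood of
      \<open>\<nu>\<close>; off \<open>\<nu>\<close> the quotient formula holds there, so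
      \<open>q\<close> inherits its limit from the continuous \<open>F\<close>.\<close>
    have "open (- (\<int> - {\<nu>}))" by (intro open_Compl closed_subset_Ints) auto
    then have "eventually (\<lambda>\<mu>. F \<mu> / 2 = q \<mu>) (at \<nu>)"
      unfolding eventually_at_topological
    proof (intro exI[of _ "- (\<int> - {\<nu>})"] conjI ballI impI)
      fix \<mu> assume "\<mu> \<in> - (\<int> - {\<nu>})" "\<mu> \<noteq> \<nu>"
      then show "F \<mu> / 2 = q \<mu>" by (intro q) blast
    qed auto
    moreover have "((\<lambda>\<mu>. F \<mu> / 2) \<longlongrightarrow> F \<nu> / 2) (at \<nu>)"
      unfolding F_def by (intro tendsto_intros tendsto_cosh_integral t) auto
    ultimately show "(q \<longlongrightarrow> F \<nu> / 2) (at \<nu>)"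
      using Lim_transform_eventually by blast
  qed simp
  then have "bessel_K \<nu> t = F \<nu> / 2"
    using q[of \<nu>] by (auto simp: bessel_K_def Let_def q_def)
  then show ?thesis by (simp add: F_def mult.commute)
qed

section \<open>The recurrence for the finite sum\<close>

text \<open>Inserting the recurrence of \<open>u\<close> into \<open>z^2 * T n\<close> and shifting
  indices produces the denominators \<open>n + 2 - j\<close> and \<open>n + 1 - j\<close>. They
  match those of the other sums because \<open>((n+2)(n+1) - j(j-1)) / (n+2-j)\<close> and
  \<open>((n+1)^2 - j^2) / (n+1-j)\<close> both equal \<open>n + 1 + j\<close>.\<close>

lemma weighted_sum_rec:
  fixes u :: "nat \<Rightarrow> 'a :: field_char_0"
  assumes rec: "\<And>k. of_nat (k + 2) * of_nat (k + 1) * u (k + 2) = z\<^sup>2 * u k + (of_nat (k + 1))\<^sup>2 * u (k + 1)"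
  defines "T \<equiv> \<lambda>m. \<Sum>k<m. u k / (of_nat m - of_nat k)"
  shows "of_nat (n + 2) * of_nat (n + 1) * T (n + 2) =
         z\<^sup>2 * T n + 2 * of_nat (n + 1) * u (n + 1) + (of_nat (n + 1))\<^sup>2 * T (n + 1)"
proof -
  let ?N = "of_nat n :: 'a"
  define f where "f = (\<lambda>j. of_nat j * (of_nat j - 1) * u j / (?N + 2 - of_nat j))"
  define g where "g = (\<lambda>j. (of_nat j)\<^sup>2 * u j / (?N + 1 - of_nat j))"
  have "z\<^sup>2 * T n = (\<Sum>k<n. f (Suc (Suc k)) - g (Suc k))"
    unfolding T_def sum_distrib_left
  proof (rule sum.cong)
    fix k assume "k \<in> {..<n}"
    have "z\<^sup>2 * u k = of_nat (k + 2) * of_nat (k + 1) * u (k + 2) - (of_nat (k + 1))\<^sup>2 * u (k + 1)"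
      using rec[of k] by simp
    then have "z\<^sup>2 * u k / (of_nat n - of_nat k) =
        of_nat (k + 2) * of_nat (k + 1) * u (k + 2) / (of_nat n - of_nat k) - (of_nat (k + 1))\<^sup>2 * u (k + 1) / (of_nat n - of_nat k)"
      by (simp only: diff_divide_distrib)
    then show "z\<^sup>2 * (u k / (of_nat n - of_nat k)) = f (Suc (Suc k)) - g (Suc k)"
      by (simp add: f_def g_def add_ac)
  qed simp
  \<comment> \<open>The added terms \<open>f 0\<close>, \<open>f 1\<close> and \<open>g 0\<close>
    all vanish.\<close>
  also have "\<dots> = (\<Sum>k<Suc (Suc n). f k) - (\<Sum>k<Suc n. g k)"
    unfolding sum.lessThan_Suc_shift[of f] sum.lessThan_Suc_shift[of g] sum.lessThan_Suc_shift[of "\<lambda>k. f (Suc k)"]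
    by (simp add: sum_subtractf f_def g_def)
  \<comment> \<open>The last \<open>f\<close> term, at index \<open>n + 1\<close>, has denominator
    \<open>1\<close>. Subtracted from \<open>(n+2)(n+1)\<close>, its coefficient leaves the
    \<open>2 * (n + 1)\<close> of the claim.\<close>
  also have "\<dots> = ?N * (?N + 1) * u (n + 1) + (\<Sum>k<Suc n. f k - g k)"
    by (simp add: sum_subtractf f_def algebra_simps)
  finally have 1: "z\<^sup>2 * T n = ?N * (?N + 1) * u (n + 1) + (\<Sum>k<Suc n. f k - g k)" .
  have 2: "T (n + 2) = u (n + 1) + (\<Sum>k<Suc n. u k / (?N + 2 - of_nat k))"
    by (simp add: T_def algebra_simps)
  have 3: "T (n + 1) = (\<Sum>k<Suc n. u k / (?N + 1 - of_nat k))"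
    by (simp add: T_def algebra_simps)
  have "(\<Sum>k<Suc n. (?N + 2) * (?N + 1) * (u k / (?N + 2 - of_nat k))) =
      (\<Sum>k<Suc n. (f k - g k) + (?N + 1)\<^sup>2 * (u k / (?N + 1 - of_nat k)))"
  proof (rule sum.cong)
    fix k assume "k \<in> {..<Suc n}"
    then have "?N + 1 - of_nat k = of_nat (n + 1 - k)" "?N + 2 - of_nat k = of_nat (n + 2 - k)"
      "n + 1 - k \<noteq> 0" "n + 2 - k \<noteq> 0"
      by (auto simp: of_nat_diff)
    then have nz: "?N + 1 - of_nat k \<noteq> 0" "?N + 2 - of_nat k \<noteq> 0" by (metis of_nat_eq_0_iff)+
    \<comment> \<open>In terms of \<open>a\<close> the denominators are \<open>a\<close> and
      \<open>a + 1\<close>, and clearing them leaves a polynomial identity.\<close>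
    define a where "a = ?N + 1 - of_nat k"
    have N: "?N = a + of_nat k - 1" by (simp add: a_def)
    have nz: "a \<noteq> 0" "a + 1 \<noteq> 0" using nz by (simp_all add: a_def algebra_simps)
    have e: "?N + 2 - of_nat k = a + 1" "?N + 1 - of_nat k = a" by (simp_all add: a_def)
    show "(?N + 2) * (?N + 1) * (u k / (?N + 2 - of_nat k)) = (f k - g k) + (?N + 1)\<^sup>2 * (u k / (?N + 1 - of_nat k))"
      unfolding f_def g_def e using nz
      by (simp add: divide_simps) (simp add: N power2_eq_square algebra_simps)
  qed simp
  then have "(?N + 2) * (?N + 1) * (\<Sum>k<Suc n. u k / (?N + 2 - of_nat k)) =
      (\<Sum>k<Suc n. f k - g k) + (?N + 1)\<^sup>2 * T (n + 1)"
    unfolding 3 sum_distrib_left sum.distrib by (simp only:)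
  then have "(?N + 2) * (?N + 1) * T (n + 2) = (?N + 2) * (?N + 1) * u (n + 1) + ((\<Sum>k<Suc n. f k - g k) + (?N + 1)\<^sup>2 * T (n + 1))"
    unfolding 2 by (simp only: distrib_left)
  then show ?thesis unfolding 1
    by (simp add: algebra_simps)
qed

lemma powi_diff_of_nat: "z \<noteq> 0 \<Longrightarrow> z powi (int k - int m) = z ^ k / z ^ m" for z :: complex
  by (simp add: power_int_diff)

text \<open>Setting \<open>u k = \<kappa> k * z^k / k!\<close> absorbs the powers of
  \<open>z\<close> and reduces the claim to \<open>weighted_sum_rec\<close>; the factor
  \<open>n! / z^(n+1)\<close> translates back.\<close>

lemma order_derivative_sum_rec:
  fixes \<kappa> :: "nat \<Rightarrow> complex"
  assumes z: "z \<noteq> 0" and rec: "\<And>k. z * (\<kappa> (k + 2) - \<kappa> k) = of_nat (k + 1) * \<kappa> (k + 1)"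
  defines "S \<equiv> \<lambda>m. fact m * (\<Sum>k<m. \<kappa> k / (fact k * (of_nat m - of_nat k)) * z powi (int k - int m))"
  shows "z * (S (n + 2) - S n) = 2 * \<kappa> (n + 1) + of_nat (n + 1) * S (n + 1)"
proof -
  define u where "u = (\<lambda>k. \<kappa> k * z ^ k / fact k)"
  define T where "T = (\<lambda>m. \<Sum>k<m. u k / (of_nat m - of_nat k))"
  have S: "S m = fact m / z ^ m * T m" for m
    unfolding S_def T_def u_def sum_distrib_left using z
    by (intro sum.cong) (simp_all add: powi_diff_of_nat)
  have "of_nat (k + 2) * of_nat (k + 1) * u (k + 2) = z\<^sup>2 * u k + (of_nat (k + 1))\<^sup>2 * u (k + 1)" for k
  proof -
    have "of_nat (k + 2) * of_nat (k + 1) * u (k + 2) = z ^ (k + 1) / fact k * (z * \<kappa> (k + 2))"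
      using of_nat_neq_0[of k, where ?'a = complex] of_nat_neq_0[of "Suc k", where ?'a = complex]
      by (simp add: u_def power2_eq_square divide_simps)
    moreover have "z * \<kappa> (k + 2) = z * \<kappa> k + of_nat (k + 1) * \<kappa> (k + 1)"
      using rec[of k] by (simp add: algebra_simps)
    moreover have "z ^ (k + 1) / fact k * (z * \<kappa> k) = z\<^sup>2 * u k"
      by (simp add: u_def power2_eq_square)
    moreover have "z ^ (k + 1) / fact k * (of_nat (k + 1) * \<kappa> (k + 1)) = (of_nat (k + 1))\<^sup>2 * u (k + 1)"
      using of_nat_neq_0[of k, where ?'a = complex] by (simp add: u_def power2_eq_square divide_simps)
    ultimately show ?thesis by (simp only: distrib_left)
  qed
  from weighted_sum_rec[of u, OF this, of n]
  have T: "of_nat (n + 2) * of_nat (n + 1) * T (n + 2) =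
         z\<^sup>2 * T n + 2 * of_nat (n + 1) * u (n + 1) + (of_nat (n + 1))\<^sup>2 * T (n + 1)"
    by (simp only: T_def)
  have "z * S (n + 2) = fact n / z ^ (n + 1) * (of_nat (n + 2) * of_nat (n + 1) * T (n + 2))"
    unfolding S using z by (simp add: fact_reduce divide_simps)
  moreover have "fact n / z ^ (n + 1) * (z\<^sup>2 * T n) = z * S n"
    unfolding S using z by (simp add: divide_simps power2_eq_square)
  moreover have "fact n / z ^ (n + 1) * (2 * of_nat (n + 1) * u (n + 1)) = 2 * \<kappa> (n + 1)"
    using z of_nat_neq_0[of n, where ?'a = complex] by (simp add: u_def divide_simps)
  moreover have "fact n / z ^ (n + 1) * ((of_nat (n + 1))\<^sup>2 * T (n + 1)) = of_nat (n + 1) * S (n + 1)"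
    unfolding S by (simp add: power2_eq_square)
  ultimately have "z * S (n + 2) = z * S n + 2 * \<kappa> (n + 1) + of_nat (n + 1) * S (n + 1)"
    unfolding T by (simp only: distrib_left)
  then show ?thesis by (simp add: algebra_simps)
qed

section \<open>Identification of the integral with the finite sum\<close>

theorem corollary3p14:
  fixes t s :: complex and m :: nat
  assumes "Re t > 0"
    and "s = 1 \<or> s = - 1"
  shows "has_bochner_integral lborel
           (\<lambda>x::real. of_real x * exp (s * of_nat m * of_real x - t * of_real (cosh x)))
           (s * fact m *
             (\<Sum>k<m. bessel_K (of_nat k) t / (fact k * (of_nat m - of_nat k))
                       * (t / 2) powi (int k - int m)))"
proof -
  define z where "z = t / 2"
  have z: "z \<noteq> 0" using assms(1) by (auto simp: z_def)
  define \<kappa> where "\<kappa> = (\<lambda>k. bessel_K (of_nat k) t)"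
  define S where "S = (\<lambda>m. fact m * (\<Sum>k<m. \<kappa> k / (fact k * (of_nat m - of_nat k)) * z powi (int k - int m)))"
  define G where "G = (\<lambda>\<mu>. LBINT x. of_real x * exp (\<mu> * of_real x - t * of_real (cosh x)))"
  define F where "F = (\<lambda>\<mu>. LBINT x. exp (\<mu> * of_real x - t * of_real (cosh x)))"
  have F: "F (of_nat k) = 2 * \<kappa> k" for k
    using cosh_integral_eq_bessel_K[OF assms(1)] by (simp add: F_def \<kappa>_def)
  have K_rec: "z * (\<kappa> (k + 2) - \<kappa> k) = of_nat (k + 1) * \<kappa> (k + 1)" for k
  proof -
    have "z * (F (of_nat (k + 1) + 1) - F (of_nat (k + 1) - 1)) = of_nat (k + 1) * F (of_nat (k + 1))"
      unfolding F_def z_def by (rule cosh_integral_rec[OF assms(1)])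
    moreover have "of_nat (k + 1) + 1 = complex_of_nat (k + 2)" "of_nat (k + 1) - 1 = complex_of_nat k"
      by simp_all
    ultimately have "2 * (z * (\<kappa> (k + 2) - \<kappa> k)) = 2 * (of_nat (k + 1) * \<kappa> (k + 1))"
      unfolding F by (simp only: F mult.left_commute right_diff_distrib)
    then show ?thesis by (simp only: mult_cancel_left) simp
  qed
  have S_rec: "z * (S (n + 2) - S n) = 2 * \<kappa> (n + 1) + of_nat (n + 1) * S (n + 1)" for n
    unfolding S_def by (rule order_derivative_sum_rec[OF z K_rec])
  \<comment> \<open>The subtraction in \<open>of_nat n - 1\<close> is complex: at
    \<open>n = 0\<close> the order is \<open>- 1\<close>, where oddness of \<open>G\<close>
    applies.\<close>
  have G_rec: "z * (G (of_nat (n + 1)) - G (of_nat n - 1)) = 2 * \<kappa> n + of_nat n * G (of_nat n)" for n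
  proof -
    have "z * (G (of_nat n + 1) - G (of_nat n - 1)) = F (of_nat n) + of_nat n * G (of_nat n)"
      unfolding F_def G_def z_def by (rule times_cosh_integral_rec[OF assms(1)])
    then show ?thesis unfolding F by (simp add: add.commute)
  qed
  have G_minus: "G (- \<mu>) = - G \<mu>" for \<mu>
    unfolding G_def by (rule times_cosh_integral_uminus)
  \<comment> \<open>The recurrence links orders two apart, so the induction carries two consecutive
    values.\<close>
  have "G (of_nat n) = S n \<and> G (of_nat (n + 1)) = S (n + 1)" for n
  proof (induction n)
    case 0
    have "G 0 = 0" using G_minus[of 0] by simp
    \<comment> \<open>The recurrence at \<open>n = 0\<close> together with
      \<open>G (- 1) = - G 1\<close> gives \<open>2 * z * G 1 = 2 * \<kappa> 0\<close>.\<close>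
    moreover have "G 1 = \<kappa> 0 / z"
      using G_rec[of 0] G_minus[of 1] z by (simp add: field_simps)
    ultimately show ?case by (simp add: S_def power_int_minus divide_inverse)
  next
    case (Suc n)
    have "z * (G (of_nat (n + 2)) - G (of_nat n)) = z * (S (n + 2) - S n)"
      using G_rec[of "n + 1"] S_rec[of n] Suc.IH by (simp add: algebra_simps)
    then have "G (of_nat (n + 2)) = S (n + 2)" using z Suc.IH by simp
    with Suc.IH show ?case by simp
  qed
  then have "G (of_nat m) = S m" by blast
  \<comment> \<open>For \<open>s = - 1\<close> this is the oddness of \<open>G\<close>.\<close>
  then have "G (s * of_nat m) = s * S m"
    using assms(2) G_minus by auto
  then show ?thesis
    using integrable_cosh_kernel(2)[OF assms(1), of "s * of_nat m"]
    by (simp add: has_bochner_integral_iff G_def S_def \<kappa>_def z_def mult.assoc)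
qed

end
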